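(* Fix $\beta>0$. Assume that $\mathbb{E}[\eta]=0$, $\mathrm{Var}[\eta]\in(0,\infty)$ and $$\mathbb{P}\{\eta>x\}\sim\frac{1}{(x\log x)^2},\quad x\to\infty.$$ Then there exists a deterministic sequence $(a_k)_{k\ge1}$ of real numbers satisfying $$\sum_{k\ge1}\frac{a_k^2}{k}=\infty,\qquad \sum_{k\ge1}\frac{a_k^2}{k^{1+2s}}<\infty\ \text{ for every } s>0,$$ and $$\sum_{k\le n}\frac{a_k^2}{k}\sim c(\log n)^\beta,\quad n\to\infty$$ for some $c>0$, for which $$\limsup_{s\to0+}\frac{s^{\beta/2}}{(\log\log 1/s)^{1/2}}X(s)=+\infty\quad\text{a.s.}$$
   Context: $\eta_1,\eta_2,\ldots$ are independent copies of the random variable $\eta$. For $s>0$, $X(s):=\sum_{k\ge1}\frac{a_k\eta_k}{k^{1/2+s}}$ (the series converges a.s. for each $s>0$). $f\sim g$ means that the ratio $f/g$ tends to $1$. *)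

theory Defs
  imports "HOL-Probability.Probability" "HOL-Library.Landau_Symbols"
begin

text \<open>
  Sequences are indexed by \<open>k \<ge> 1\<close>; the entry at index \<open>0\<close> is never used. The copies may live on a
  probability space \<open>M\<close> different from the space \<open>N\<close> carrying \<open>\<eta>\<close>.
\<close>

definition independent_copies ::
  "'a measure \<Rightarrow> (nat \<Rightarrow> 'a \<Rightarrow> real) \<Rightarrow> 'b measure \<Rightarrow> ('b \<Rightarrow> real) \<Rightarrow> bool" where
  "independent_copies M \<eta>s N \<eta> \<longleftrightarrow>
     prob_space.indep_vars M (\<lambda>_. borel) \<eta>s {1..} \<and>
     (\<forall>k\<ge>1. distr M borel (\<eta>s k) = distr N borel \<eta>)"

text \<open>
  The series is taken as the limit of its partial sums, so the value is only meaningful at those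
  \<open>s\<close> and \<open>\<omega>\<close> where it converges. When \<open>a\<^sub>k\<^sup>2 / k\<^bsup>1+2s\<^esup>\<close> is summable for every \<open>s > 0\<close> and the \<open>\<eta>s k\<close>
  are i.i.d. centred with finite variance, the series converges almost surely for all \<open>s > 0\<close>
  simultaneously.
\<close>

definition random_dirichlet ::
  "(nat \<Rightarrow> real) \<Rightarrow> (nat \<Rightarrow> 'a \<Rightarrow> real) \<Rightarrow> real \<Rightarrow> 'a \<Rightarrow> real" where
  "random_dirichlet a \<eta>s s \<omega> =
     (\<Sum>k. a (Suc k) * \<eta>s (Suc k) \<omega> / real (Suc k) powr (1/2 + s))"

end

theory Submission
  imports Defs "HOL-Real_Asymp.Real_Asymp"
begin

text \<open>
  Let \<open>a\<close> be supported on lacunary indices \<open>K\<^sub>j = 2 ^ m\<^sub>j\<close> with \<open>m\<^sub>j \<approx> exp (j powr (7/8))\<close>, so that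
  \<open>m\<^sub>j\<^sub>+\<^sub>1 / m\<^sub>j \<rightarrow> 1\<close>, and let the values of \<open>a\<^sub>k\<^sup>2 / k\<close> there be the increments of
  \<open>exp (\<beta> * j powr (7/8)) \<approx> m\<^sub>j powr \<beta>\<close>. At \<open>s\<^sub>j = 1 / m\<^sub>j\<close> the coefficients of the series \<open>X(s\<^sub>j)\<close> have an
  absolute sum of at most \<open>O(j powr (3/16))\<close> times the coefficient at \<open>K\<^sub>j\<close>. Put \<open>x\<^sub>j = j powr (7/16)\<close>, and
  let \<open>A\<^sub>j\<close> be the event that the variable at \<open>K\<^sub>j\<close> exceeds \<open>x\<^sub>j\<close>. Up to logarithms \<open>A\<^sub>j\<close> has
  probability \<open>j powr (-7/8)\<close>, so infinitely many \<open>A\<^sub>j\<close> occur. By pairwise independence and Markov's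
  inequality for the sum of the absolute values of the other terms, the event that \<open>A\<^sub>j\<close> occurs and the
  other terms cancel half of the \<open>j\<close>-th one has probability \<open>O(j powr (-7/8 + 3/16 - 7/16))\<close>, which is
  summable. So almost surely the \<open>j\<close>-th term is infinitely often both large and dominant, which lifts
  \<open>X(s\<^sub>j)\<close> above the claimed normalisation by a power of \<open>j\<close>.
\<close>

section \<open>Independence along a subsequence and the second Borel-Cantelli lemma\<close>

lemma (in prob_space) indep_vars_reindex:
  assumes "inj_on g J" "g ` J \<subseteq> I" "indep_vars (\<lambda>_. N) X I"
  shows "indep_vars (\<lambda>_. N) (\<lambda>j. X (g j)) J"
proof -
  let ?F = "\<lambda>i. sigma_sets (space M) {X i -` A \<inter> space M | A. A \<in> sets N}"
  have F: "indep_sets ?F I" and meas: "\<And>i. i \<in> I \<Longrightarrow> X i \<in> measurable M N"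
    using assms(3) by (auto simp: indep_vars_def)
  have "indep_sets (\<lambda>j. ?F (g j)) J"
  proof (rule indep_setsI)
    show "?F (g j) \<subseteq> events" if "j \<in> J" for j
      using F assms(2) that by (auto simp: indep_sets_def)
  next
    fix A J' assume J': "J' \<noteq> {}" "J' \<subseteq> J" "finite J'" "\<forall>j\<in>J'. A j \<in> ?F (g j)"
    have inj: "inj_on g J'"
      using assms(1) J'(2) by (rule inj_on_subset)
    \<comment> \<open>Moves the events from \<open>J'\<close> to its image under \<open>g\<close>,
      where the independence of \<open>X\<close> applies; injectivity identifies the two
      products.\<close>
    define B where "B = A \<circ> the_inv_into J' g"
    have B: "B (g j) = A j" if "j \<in> J'" for j
      using inj that by (simp add: B_def the_inv_into_f_f)
    have "prob (\<Inter>i\<in>g ` J'. B i) = (\<Prod>i\<in>g ` J'. prob (B i))"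
      by (rule indep_setsD[OF F]) (use J' assms(2) B in auto)
    then show "prob (\<Inter>j\<in>J'. A j) = (\<Prod>j\<in>J'. prob (A j))"
      using B inj by (simp add: prod.reindex image_image)
  qed
  then show ?thesis
    using meas assms(2) by (auto simp: indep_vars_def)
qed

text \<open>By independence and \<open>1 - p \<le> exp (- p)\<close>, no event occurs on a finite
  stretch with probability at most the exponential of minus the sum of the probabilities there. If
  avoiding all events from \<open>k\<close> on had positive probability, the partial sums would be
  bounded.\<close>

lemma (in prob_space) borel_cantelli_AE2:
  fixes X :: "nat \<Rightarrow> 'a \<Rightarrow> 'b"
  assumes ind: "indep_vars (\<lambda>_. N) X UNIV" and B: "\<And>n. B n \<in> sets N"
    and nsum: "\<not> summable (\<lambda>n. prob (X n -` B n \<inter> space M))"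
  shows "AE \<omega> in M. \<exists>\<^sub>F n in sequentially. X n \<omega> \<in> B n"
proof -
  let ?p = "\<lambda>n. prob (X n -` B n \<inter> space M)"
  have X[measurable]: "X n \<in> measurable M N" for n
    using ind by (auto simp: indep_vars_def)
  note B[measurable]
  have "AE \<omega> in M. \<exists>n\<ge>k. X n \<omega> \<in> B n" for k
  proof -
    let ?E = "\<lambda>J. \<Inter>i\<in>J. X i -` (space N - B i) \<inter> space M"
    have compl: "prob (X i -` (space N - B i) \<inter> space M) = 1 - ?p i" for i
    proof -
      have "X i -` (space N - B i) \<inter> space M = space M - (X i -` B i \<inter> space M)"
        using measurable_space[OF X] by auto
      then show ?thesis
        by (simp add: prob_compl)
    qed
    \<comment> \<open>\<open>Suc n\<close> keeps the index range nonempty; the intersection over the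
      empty range would be \<open>UNIV\<close>.\<close>
    have le: "prob (?E {k..<k + Suc n}) \<le> exp (- (\<Sum>i=k..<k + Suc n. ?p i))" for n
    proof -
      have "prob (?E {k..<k + Suc n}) = (\<Prod>i=k..<k + Suc n. 1 - ?p i)"
        by (subst indep_varsD[OF ind]) (auto simp: compl)
      also have "\<dots> \<le> (\<Prod>i=k..<k + Suc n. exp (- ?p i))"
        using exp_ge_add_one_self[of "- ?p i" for i] by (intro prod_mono) auto
      also have "\<dots> = exp (- (\<Sum>i=k..<k + Suc n. ?p i))"
        by (subst exp_sum[symmetric]) (simp_all only: sum_negf finite_atLeastLessThan)
      finally show ?thesis .
    qed
    have "prob (?E {k..}) = 0"
    proof (rule ccontr)
      assume "prob (?E {k..}) \<noteq> 0"
      then have pos: "0 < prob (?E {k..})"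
        by (simp add: zero_less_measure_iff)
      have "(\<Sum>i<n. ?p (i + k)) \<le> - ln (prob (?E {k..}))" for n
      proof -
        have "prob (?E {k..}) \<le> prob (?E {k..<k + Suc n})"
          by (intro finite_measure_mono sets.finite_INT measurable_sets[OF X]) auto
        with le[of n] pos have "ln (prob (?E {k..})) \<le> ln (exp (- (\<Sum>i=k..<k + Suc n. ?p i)))"
          by (subst ln_le_cancel_iff) auto
        then have "ln (prob (?E {k..})) \<le> - (\<Sum>i=k..<k + Suc n. ?p i)"
          by (simp only: ln_exp)
        moreover have "(\<Sum>i<n. ?p (i + k)) = (\<Sum>i=k..<k + n. ?p i)"
          using sum.shift_bounds_nat_ivl[of ?p 0 k n] by (simp add: atLeast0LessThan add.commute)
        moreover have "(\<Sum>i=k..<k + n. ?p i) \<le> (\<Sum>i=k..<k + Suc n. ?p i)"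
          by (intro sum_mono2) auto
        ultimately show ?thesis
          by linarith
      qed
      then have "summable (\<lambda>i. ?p (i + k))"
        by (intro summableI_nonneg_bounded) auto
      with nsum show False
        using summable_iff_shift[of ?p k] by blast
    qed
    moreover have "?E {k..} \<in> events"
      by (intro sets.countable_INT' measurable_sets[OF X]) auto
    ultimately have "AE \<omega> in M. \<omega> \<notin> ?E {k..}"
      by (subst AE_iff_measurable[where N="?E {k..}"]) (auto simp: emeasure_eq_measure)
    with AE_space show ?thesis
      by eventually_elim (use measurable_space[OF X] in auto)
  qed
  then have "AE \<omega> in M. \<forall>k. \<exists>n\<ge>k. X n \<omega> \<in> B n"
    by (simp add: AE_all_countable)
  then show ?thesis
    by (simp add: frequently_sequentially)
qed

section \<open>A single dominant term in a weighted random series\<close>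

text \<open>The second Borel-Cantelli lemma yields infinitely many \<open>j\<close> with
  \<open>x j < \<xi> j\<close>. On such an event the off-diagonal absolute sum has mean at most
  \<open>L * suminf (u j)\<close> times the probability of the event, so Markov's inequality,
  \<open>sum\<close> and the first Borel-Cantelli lemma eventually exclude that it reaches
  \<open>u j j * x j / 2\<close>.\<close>

lemma (in prob_space) weighted_series_exceeds_single_term:
  fixes \<xi> :: "nat \<Rightarrow> 'a \<Rightarrow> real" and u :: "nat \<Rightarrow> nat \<Rightarrow> real" and x :: "nat \<Rightarrow> real"
  assumes ind: "indep_vars (\<lambda>_. borel) \<xi> UNIV"
    and L: "\<And>i. (\<integral>\<^sup>+\<omega>. ennreal \<bar>\<xi> i \<omega>\<bar> \<partial>M) \<le> ennreal L" "0 \<le> L"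
    and u: "\<And>j i. 0 \<le> u j i" "\<And>j. 0 < u j j" "\<And>j. summable (u j)"
    and x: "\<And>j. 0 < x j"
    and nsum: "\<not> summable (\<lambda>j. prob {\<omega>\<in>space M. x j < \<xi> j \<omega>})"
    and sum: "summable (\<lambda>j. prob {\<omega>\<in>space M. x j < \<xi> j \<omega>} * suminf (u j) / (u j j * x j))"
  shows "AE \<omega> in M. \<exists>\<^sub>F j in sequentially. u j j * x j / 2 \<le> (\<Sum>i. u j i * \<xi> i \<omega>)"
proof -
  let ?A = "\<lambda>j. {\<omega>\<in>space M. x j < \<xi> j \<omega>}"
  \<comment> \<open>Values in \<open>ennreal\<close> make the off-diagonal sum \<open>?T j\<close>
    meaningful before convergence is known. \<open>?c j\<close> is scaled so that
    \<open>1 \<le> ?c j * ?T j\<close> means that \<open>?T j\<close> is at least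
    \<open>u j j * x j / 2\<close>.\<close>
  let ?T = "\<lambda>j \<omega>. \<Sum>i. ennreal (if i = j then 0 else u j i * \<bar>\<xi> i \<omega>\<bar>)"
  let ?c = "\<lambda>j. ennreal (2 / (u j j * x j))"
  have \<xi>[measurable]: "\<xi> i \<in> borel_measurable M" for i
    using ind by (auto simp: indep_vars_def)
  have "AE \<omega> in M. \<exists>\<^sub>F j in sequentially. \<xi> j \<omega> \<in> {x j<..}"
    using nsum by (intro borel_cantelli_AE2[OF ind]) (auto simp: vimage_def Int_def conj_commute)
  then have big: "AE \<omega> in M. \<exists>\<^sub>F j in sequentially. x j < \<xi> j \<omega>"
    by simp
  have int_term: "(\<integral>\<^sup>+\<omega>. ennreal (if i = j then 0 else u j i * \<bar>\<xi> i \<omega>\<bar>) * indicator (?A j) \<omega> \<partial>M)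
      \<le> ennreal (u j i * (L * prob (?A j)))" for i j
  proof (cases "i = j")
    case False
    \<comment> \<open>Casts the absolute value at \<open>i\<close> and the indicator at
      \<open>j\<close> as one indexed family, as the product rule for independent variables
      requires.\<close>
    define Y where "Y l y = (if l = j then indicator {x j<..} y else ennreal \<bar>y\<bar>)" for l and y :: real
    have [measurable]: "Y l \<in> borel_measurable borel" for l
      by (cases "l = j") (simp_all add: Y_def[abs_def])
    have "indep_vars (\<lambda>_. borel) \<xi> {i, j}"
      using ind by (rule indep_vars_subset) auto
    then have "indep_vars (\<lambda>_. borel) (\<lambda>l \<omega>. Y l (\<xi> l \<omega>)) {i, j}"
      by (rule indep_vars_compose2) simp
    then have "(\<integral>\<^sup>+\<omega>. (\<Prod>l\<in>{i, j}. Y l (\<xi> l \<omega>)) \<partial>M) = (\<Prod>l\<in>{i, j}. \<integral>\<^sup>+\<omega>. Y l (\<xi> l \<omega>) \<partial>M)"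
      by (intro indep_vars_nn_integral) auto
    then have "(\<integral>\<^sup>+\<omega>. ennreal \<bar>\<xi> i \<omega>\<bar> * indicator {x j<..} (\<xi> j \<omega>) \<partial>M) =
        (\<integral>\<^sup>+\<omega>. ennreal \<bar>\<xi> i \<omega>\<bar> \<partial>M) * (\<integral>\<^sup>+\<omega>. indicator {x j<..} (\<xi> j \<omega>) \<partial>M)"
      using False by (simp add: Y_def)
    also have "(\<integral>\<^sup>+\<omega>. indicator {x j<..} (\<xi> j \<omega>) \<partial>M) = (\<integral>\<^sup>+\<omega>. indicator (?A j) \<omega> \<partial>M)"
      by (intro nn_integral_cong) (auto simp: indicator_def)
    also have "\<dots> = emeasure M (?A j)"
      by (subst nn_integral_indicator) auto
    finally have *: "(\<integral>\<^sup>+\<omega>. ennreal \<bar>\<xi> i \<omega>\<bar> * indicator {x j<..} (\<xi> j \<omega>) \<partial>M) \<le> ennreal (L * prob (?A j))"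
      using L by (simp add: emeasure_eq_measure ennreal_mult mult_right_mono)
    have "(\<integral>\<^sup>+\<omega>. ennreal (if i = j then 0 else u j i * \<bar>\<xi> i \<omega>\<bar>) * indicator (?A j) \<omega> \<partial>M)
      = (\<integral>\<^sup>+\<omega>. ennreal (u j i) * (ennreal \<bar>\<xi> i \<omega>\<bar> * indicator {x j<..} (\<xi> j \<omega>)) \<partial>M)"
      using False u(1) by (intro nn_integral_cong) (auto simp: indicator_def ennreal_mult)
    also have "\<dots> = ennreal (u j i) * (\<integral>\<^sup>+\<omega>. ennreal \<bar>\<xi> i \<omega>\<bar> * indicator {x j<..} (\<xi> j \<omega>) \<partial>M)"
      by (rule nn_integral_cmult) measurable
    also have "\<dots> \<le> ennreal (u j i) * ennreal (L * prob (?A j))"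
      using * by (intro mult_left_mono) auto
    also have "\<dots> = ennreal (u j i * (L * prob (?A j)))"
      using u(1) L by (simp add: ennreal_mult)
    finally show ?thesis .
  qed simp
  \<comment> \<open>The bad event: the \<open>j\<close>-th variable is large, yet the other terms
    may cancel half of its term.\<close>
  let ?F = "\<lambda>j. {\<omega>\<in>?A j. 1 \<le> ?c j * ?T j \<omega>}"
  have F_meas: "?F j \<in> events" for j
    by measurable
  have F_le: "emeasure M (?F j) \<le> ennreal (2 * L * (prob (?A j) * suminf (u j) / (u j j * x j)))" for j
  proof -
    have "emeasure M (?F j) \<le> ?c j * (\<integral>\<^sup>+\<omega>. ?T j \<omega> * indicator (?A j) \<omega> \<partial>M)"
      by (rule nn_integral_Markov_inequality) measurable
    also have "(\<integral>\<^sup>+\<omega>. ?T j \<omega> * indicator (?A j) \<omega> \<partial>M) =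
        (\<Sum>i. \<integral>\<^sup>+\<omega>. ennreal (if i = j then 0 else u j i * \<bar>\<xi> i \<omega>\<bar>) * indicator (?A j) \<omega> \<partial>M)"
      unfolding ennreal_suminf_multc[symmetric] by (rule nn_integral_suminf) measurable
    also have "\<dots> \<le> (\<Sum>i. ennreal (u j i * (L * prob (?A j))))"
      by (intro suminf_le int_term) auto
    also have "\<dots> = ennreal (suminf (u j) * (L * prob (?A j)))"
      using u L by (subst suminf_ennreal2) (auto simp: suminf_mult2 intro!: summable_mult2)
    finally have "emeasure M (?F j) \<le> ?c j * ennreal (suminf (u j) * (L * prob (?A j)))"
      by (simp add: mult_left_mono)
    also have "\<dots> = ennreal (2 * L * (prob (?A j) * suminf (u j) / (u j j * x j)))"
      using u L x by (simp add: ennreal_mult[symmetric] suminf_nonneg less_imp_le field_simps)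
    finally show ?thesis .
  qed
  have "summable (\<lambda>j. prob (?F j))"
  proof (rule summable_comparison_test_ev[OF _ summable_mult[OF sum, of "2 * L"]])
    show "\<forall>\<^sub>F j in sequentially. norm (prob (?F j)) \<le> 2 * L * (prob (?A j) * suminf (u j) / (u j j * x j))"
      using F_le L u x by (auto simp: emeasure_eq_measure suminf_nonneg less_imp_le intro!: always_eventually)
  qed
  then have F: "AE \<omega> in M. \<forall>\<^sub>F j in sequentially. \<omega> \<in> space M - ?F j"
    by (intro borel_cantelli_AE1 F_meas) (auto simp: emeasure_eq_measure)
  \<comment> \<open>A finite mean of the absolute series gives absolute convergence almost surely,
    which allows the passage from \<open>ennreal\<close> back to real sums.\<close>
  have fin: "AE \<omega> in M. summable (\<lambda>i. u j i * \<bar>\<xi> i \<omega>\<bar>)" for j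
  proof -
    have "(\<integral>\<^sup>+\<omega>. (\<Sum>i. ennreal (u j i * \<bar>\<xi> i \<omega>\<bar>)) \<partial>M) = (\<Sum>i. \<integral>\<^sup>+\<omega>. ennreal (u j i * \<bar>\<xi> i \<omega>\<bar>) \<partial>M)"
      by (rule nn_integral_suminf) measurable
    also have "\<dots> \<le> (\<Sum>i. ennreal (u j i * L))"
    proof (intro suminf_le)
      fix i
      have "(\<integral>\<^sup>+\<omega>. ennreal (u j i * \<bar>\<xi> i \<omega>\<bar>) \<partial>M) = ennreal (u j i) * (\<integral>\<^sup>+\<omega>. ennreal \<bar>\<xi> i \<omega>\<bar> \<partial>M)"
        using u(1) by (subst nn_integral_cmult[symmetric]) (auto simp: ennreal_mult)
      also have "\<dots> \<le> ennreal (u j i) * ennreal L"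
        by (intro mult_left_mono L) auto
      finally show "(\<integral>\<^sup>+\<omega>. ennreal (u j i * \<bar>\<xi> i \<omega>\<bar>) \<partial>M) \<le> ennreal (u j i * L)"
        using u(1) L by (simp add: ennreal_mult)
    qed auto
    also have "\<dots> < \<infinity>"
      using u L by (subst suminf_ennreal2) (auto simp: intro!: summable_mult2)
    finally have "AE \<omega> in M. (\<Sum>i. ennreal (u j i * \<bar>\<xi> i \<omega>\<bar>)) \<noteq> \<infinity>"
      by (intro nn_integral_noteq_infinite) auto
    then show ?thesis
      by eventually_elim (use u in \<open>auto intro!: summable_suminf_not_top\<close>)
  qed
  then have "AE \<omega> in M. \<forall>j. summable (\<lambda>i. u j i * \<bar>\<xi> i \<omega>\<bar>)"
    by (simp add: AE_all_countable)
  with big F show ?thesis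
  proof eventually_elim
    case (elim \<omega>)
    have "u j j * x j / 2 \<le> (\<Sum>i. u j i * \<xi> i \<omega>)" if j: "x j < \<xi> j \<omega>" "\<omega> \<in> space M - ?F j" for j
    proof -
      let ?t = "\<lambda>i. if i = j then 0 else u j i * \<bar>\<xi> i \<omega>\<bar>"
      have s: "summable (\<lambda>i. u j i * \<bar>\<xi> i \<omega>\<bar>)"
        using elim by blast
      have st: "summable ?t"
        by (rule summable_comparison_test'[OF s, of 0]) (use u in auto)
      have "?T j \<omega> = ennreal (suminf ?t)"
        using st u by (intro suminf_ennreal2) auto
      moreover have "?c j * ?T j \<omega> < 1"
        using j by (auto simp: not_le)
      moreover have "0 \<le> suminf ?t"
        using u(1) st by (intro suminf_nonneg) auto
      ultimately have "2 / (u j j * x j) * suminf ?t < 1"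
        using u(2)[of j] x[of j] by (simp add: ennreal_mult[symmetric] ennreal_less_one_iff)
      then have "suminf ?t < u j j * x j / 2"
        using u(2)[of j] x[of j] by (simp add: field_simps)
      moreover have "u j j * x j \<le> u j j * \<xi> j \<omega>"
        using u(1) j by (intro mult_left_mono) auto
      \<comment> \<open>Termwise comparison: off the diagonal each term is at least minus its
        absolute value.\<close>
      moreover have "u j j * \<xi> j \<omega> - suminf ?t \<le> (\<Sum>i. u j i * \<xi> i \<omega>)"
      proof -
        have 1: "(\<lambda>i. (if i = j then u j i * \<xi> i \<omega> else 0) - ?t i) sums (u j j * \<xi> j \<omega> - suminf ?t)"
          by (intro sums_diff summable_sums st sums_single)
        have "summable (\<lambda>i. \<bar>u j i * \<xi> i \<omega>\<bar>)"
          using s u(1) by (simp add: abs_mult)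
        then have 2: "summable (\<lambda>i. u j i * \<xi> i \<omega>)"
          by (rule summable_rabs_cancel)
        have "(if i = j then u j i * \<xi> i \<omega> else 0) - ?t i \<le> u j i * \<xi> i \<omega>" for i
          using u(1)[of j i] abs_ge_minus_self[of "u j i * \<xi> i \<omega>"] by (simp add: abs_mult)
        then show ?thesis
          by (rule sums_le[OF _ 1 summable_sums[OF 2]])
      qed
      ultimately show ?thesis by linarith
    qed
    moreover have "\<exists>\<^sub>F j in sequentially. x j < \<xi> j \<omega> \<and> \<omega> \<in> space M - ?F j"
      using elim(1,2) by (rule frequently_eventually_frequently)
    ultimately show ?case
      by (auto elim!: frequently_mono[rotated])
  qed
qed

section \<open>The lacunary support and its weights\<close>

text \<open>The summand \<open>j\<close> is negligible against the exponential; it secures strict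
  monotonicity and makes up for the rounding, so that the exponential is a lower bound.\<close>

definition lac_exp :: "nat \<Rightarrow> nat" where
  "lac_exp j = j + nat \<lfloor>exp (real j powr (7/8))\<rfloor>"

text \<open>Increments, so that partial sums telescope.\<close>

definition lac_weight :: "real \<Rightarrow> nat \<Rightarrow> real" where
  "lac_weight \<beta> j = exp (\<beta> * real (Suc j) powr (7/8)) - exp (\<beta> * real j powr (7/8))"

text \<open>The factor \<open>real k\<close> makes the squared coefficient divided by
  \<open>k\<close> equal to the weight; \<open>inv\<close> recovers \<open>j\<close>, as the powers
  are distinct.\<close>

definition lac_coeff :: "real \<Rightarrow> nat \<Rightarrow> real" where
  "lac_coeff \<beta> k = (if k \<in> range (\<lambda>j. 2 ^ lac_exp j)
     then sqrt (real k * lac_weight \<beta> (inv (\<lambda>j. 2 ^ lac_exp j) k)) else 0)"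

lemma real_lac_exp: "real (lac_exp j) = real j + real_of_int \<lfloor>exp (real j powr (7/8))\<rfloor>"
  by (simp add: lac_exp_def)

lemma strict_mono_lac_exp: "strict_mono lac_exp"
  unfolding lac_exp_def
  by (intro strict_monoI add_less_le_mono nat_mono floor_mono) (auto intro!: powr_mono2)

lemma lac_exp_ge: "j \<le> lac_exp j"
  by (simp add: lac_exp_def)

lemma exp_le_lac_exp: "exp (real j powr (7/8)) \<le> real (lac_exp j)"
proof (cases "j = 0")
  case False
  then have "1 \<le> real j" by simp
  then show ?thesis
    unfolding real_lac_exp using real_of_int_floor_add_one_gt[of "exp (real j powr (7/8))"] by linarith
qed (simp add: real_lac_exp)

lemma lac_exp_pos: "0 < lac_exp j"
  using exp_le_lac_exp[of j] exp_gt_zero[of "real j powr (7/8)"] by linarith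

lemma strict_mono_power_lac_exp: "strict_mono (\<lambda>j. 2 ^ lac_exp j :: nat)"
  using strict_mono_lac_exp by (auto simp: strict_mono_def)

lemma lac_weight_pos: "0 < \<beta> \<Longrightarrow> 0 < lac_weight \<beta> j"
  by (simp add: lac_weight_def powr_less_mono2)

lemma sum_lac_weight: "(\<Sum>j<n. lac_weight \<beta> j) = exp (\<beta> * real n powr (7/8)) - 1"
  unfolding lac_weight_def by (subst sum_lessThan_telescope) simp

lemma lac_coeff_power: "lac_coeff \<beta> (2 ^ lac_exp j) = sqrt (2 ^ lac_exp j * lac_weight \<beta> j)"
  by (simp add: lac_coeff_def inv_f_f[OF strict_mono_imp_inj_on[OF strict_mono_power_lac_exp]])

lemma lac_coeff_sq: "0 < \<beta> \<Longrightarrow> (lac_coeff \<beta> (2 ^ lac_exp j))\<^sup>2 = 2 ^ lac_exp j * lac_weight \<beta> j"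
  by (simp add: lac_coeff_power lac_weight_pos less_imp_le)

text \<open>The shift by one matches series written over \<open>Suc k\<close>.\<close>

lemma strict_mono_power_lac_exp': "strict_mono (\<lambda>j. 2 ^ lac_exp j - 1 :: nat)"
  using strict_mono_lac_exp by (auto simp: strict_mono_def intro!: diff_less_mono)

lemma lac_coeff_eq_0: "k \<notin> range (\<lambda>j. 2 ^ lac_exp j - 1) \<Longrightarrow> lac_coeff \<beta> (Suc k) = 0"
proof -
  assume k: "k \<notin> range (\<lambda>j. 2 ^ lac_exp j - 1)"
  have "Suc k \<noteq> 2 ^ lac_exp j" for j
    using k by (metis diff_Suc_1 rangeI)
  then show ?thesis
    by (auto simp: lac_coeff_def)
qed

text \<open>Drops the vanishing terms. The general \<open>h\<close> covers both the series of
  squares and the random series; the equivalence also transfers divergence.\<close>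

lemma sums_lac_coeff_iff:
  fixes h :: "real \<Rightarrow> nat \<Rightarrow> 'a::real_normed_vector"
  assumes "\<And>k. h 0 k = 0"
  shows "(\<lambda>k. h (lac_coeff \<beta> (Suc k)) (Suc k)) sums c \<longleftrightarrow>
    (\<lambda>j. h (lac_coeff \<beta> (2 ^ lac_exp j)) (2 ^ lac_exp j)) sums c"
  using sums_mono_reindex[OF strict_mono_power_lac_exp', of "\<lambda>k. h (lac_coeff \<beta> (Suc k)) (Suc k)" c]
  by (simp add: lac_coeff_eq_0 assms)

text \<open>Since \<open>lac_exp j\<close> is at least \<open>j\<close>, the geometric factor beats
  the weight, whose exponent is sublinear in \<open>j\<close>. Used with \<open>r = 1\<close> for
  squared coefficients and \<open>r = 1/2\<close> for the coefficients themselves.\<close>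

lemma summable_lac_weight:
  assumes "0 < \<beta>" "0 < c" "0 < r"
  shows "summable (\<lambda>j. lac_weight \<beta> j powr r * 2 powr (- c * real (lac_exp j)))"
proof (rule summable_comparison_test_ev)
  have "\<forall>\<^sub>F j in sequentially. exp (\<beta> * r * real (Suc j) powr (7/8)) * 2 powr (- c * real j) \<le> real j powr (-2)"
    using assms by real_asymp
  then show "\<forall>\<^sub>F j in sequentially. norm (lac_weight \<beta> j powr r * 2 powr (- c * real (lac_exp j))) \<le> real j powr (-2)"
  proof eventually_elim
    case (elim j)
    have "lac_weight \<beta> j powr r \<le> exp (\<beta> * real (Suc j) powr (7/8)) powr r"
      using assms less_imp_le[OF lac_weight_pos, of \<beta> j]
      by (intro powr_mono2) (auto simp: lac_weight_def)
    moreover have "2 powr (- c * real (lac_exp j)) \<le> 2 powr (- c * real j)"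
      using assms lac_exp_ge[of j] by (intro powr_mono) auto
    ultimately have "lac_weight \<beta> j powr r * 2 powr (- c * real (lac_exp j))
        \<le> exp (\<beta> * real (Suc j) powr (7/8)) powr r * 2 powr (- c * real j)"
      by (intro mult_mono) auto
    also have "exp (\<beta> * real (Suc j) powr (7/8)) powr r = exp (\<beta> * r * real (Suc j) powr (7/8))"
      by (simp add: powr_def[of "exp _"] mult_ac)
    finally show ?case
      using elim lac_weight_pos[of \<beta> j] assms by simp
  qed
  show "summable (\<lambda>j. real j powr (-2))"
    by (subst summable_real_powr_iff) simp
qed

section \<open>Growth conditions on the deterministic coefficients\<close>

lemma not_summable_lac_coeff:
  assumes "0 < \<beta>"
  shows "\<not> summable (\<lambda>k. (lac_coeff \<beta> (Suc k))\<^sup>2 / real (Suc k))"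
proof
  assume "summable (\<lambda>k. (lac_coeff \<beta> (Suc k))\<^sup>2 / real (Suc k))"
  then have "summable (lac_weight \<beta>)"
    using sums_lac_coeff_iff[of "\<lambda>a k. a\<^sup>2 / real k" \<beta>] assms
    by (auto simp: summable_def lac_coeff_sq)
  then have "convergent (\<lambda>n. exp (\<beta> * real n powr (7/8)) - 1)"
    by (simp add: summable_iff_convergent sum_lac_weight)
  moreover have "filterlim (\<lambda>n. exp (\<beta> * real n powr (7/8)) - 1) at_infinity sequentially"
    using assms by real_asymp
  ultimately show False
    using not_tendsto_and_filterlim_at_infinity[OF sequentially_bot] by (auto simp: convergent_def)
qed

lemma summable_lac_coeff:
  assumes "0 < \<beta>" "0 < s"
  shows "summable (\<lambda>k. (lac_coeff \<beta> (Suc k))\<^sup>2 / real (Suc k) powr (1 + 2 * s))"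
proof -
  have "(lac_coeff \<beta> (2 ^ lac_exp j))\<^sup>2 / real (2 ^ lac_exp j) powr (1 + 2 * s) =
      lac_weight \<beta> j powr 1 * 2 powr (- (2 * s) * real (lac_exp j))" for j
    using assms lac_weight_pos[of \<beta> j]
    by (simp add: lac_coeff_sq powr_add powr_minus powr_realpow[symmetric] powr_powr field_simps)
  then show ?thesis
    using summable_lac_weight[of \<beta> "2 * s" 1] assms
      sums_lac_coeff_iff[of "\<lambda>a k. a\<^sup>2 / real k powr (1 + 2 * s)" \<beta>]
    by (simp add: summable_def)
qed

text \<open>Between consecutive support points the sum is constant and \<open>ln n\<close> lies
  between \<open>lac_exp j * ln 2\<close> and \<open>lac_exp (Suc j) * ln 2\<close>. Both bounds are
  asymptotic to \<open>exp (real j powr (7/8)) * ln 2\<close>, which also explains the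
  constant.\<close>

lemma sum_lac_coeff_asymp_equiv:
  assumes "0 < \<beta>"
  shows "(\<lambda>n. \<Sum>k=1..n. (lac_coeff \<beta> k)\<^sup>2 / real k)
    \<sim>[at_top] (\<lambda>n. 1 / ln 2 powr \<beta> * ln (real n) powr \<beta>)"
proof -
  \<comment> \<open>\<open>J n\<close> counts the support points up to \<open>n\<close>.\<close>
  define J where "J n = (LEAST j. n < 2 ^ lac_exp j)" for n :: nat
  have J: "n < 2 ^ lac_exp (J n)" for n
    unfolding J_def
  proof (rule LeastI)
    show "n < 2 ^ lac_exp n"
      using less_exp[of n] power_increasing[OF lac_exp_ge[of n], of "2::nat"] by linarith
  qed
  have J_le: "2 ^ lac_exp j \<le> n" if "j < J n" for n j
    using not_less_Least[of j "\<lambda>j. n < 2 ^ lac_exp j"] that by (simp add: J_def not_less)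
  have J_iff: "j < J n \<longleftrightarrow> 2 ^ lac_exp j \<le> n" for n j
  proof
    assume "2 ^ lac_exp j \<le> n"
    with J[of n] have "(2::nat) ^ lac_exp j < 2 ^ lac_exp (J n)"
      by (rule le_less_trans[rotated])
    then show "j < J n"
      by (simp add: strict_mono_less[OF strict_mono_lac_exp])
  qed (rule J_le)
  have sum_eq: "(\<Sum>k=1..n. (lac_coeff \<beta> k)\<^sup>2 / real k) = exp (\<beta> * real (J n) powr (7/8)) - 1" for n
  proof -
    have "(\<Sum>k=1..n. (lac_coeff \<beta> k)\<^sup>2 / real k) = (\<Sum>k\<in>(\<lambda>j. 2 ^ lac_exp j) ` {..<J n}. (lac_coeff \<beta> k)\<^sup>2 / real k)"
      by (intro sum.mono_neutral_right) (auto simp: J_iff lac_coeff_def)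
    also have "\<dots> = (\<Sum>j<J n. lac_weight \<beta> j)"
      using assms strict_mono_imp_inj_on[OF strict_mono_power_lac_exp]
      by (subst sum.reindex) (auto simp: lac_coeff_sq inj_on_def)
    finally show ?thesis
      by (simp add: sum_lac_weight)
  qed
  \<comment> \<open>The quotient to be controlled, with \<open>J n = Suc j\<close> and
    \<open>ln n\<close> replaced by \<open>m * ln 2\<close>.\<close>
  let ?r = "\<lambda>m j. (exp (\<beta> * real (Suc j) powr (7/8)) - 1) / (1 / ln 2 powr \<beta> * (real m * ln 2) powr \<beta>)"
  have lim1: "(\<lambda>j. ?r (lac_exp (Suc j)) j) \<longlonglongrightarrow> 1" and lim2: "(\<lambda>j. ?r (lac_exp j) j) \<longlonglongrightarrow> 1"
    unfolding real_lac_exp using assms by real_asymp+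
  have "filterlim J at_top sequentially"
    unfolding filterlim_at_top
  proof
    fix k
    show "\<forall>\<^sub>F n in sequentially. k \<le> J n"
      using eventually_ge_at_top[of "2 ^ lac_exp k"] by eventually_elim (simp add: J_iff[symmetric])
  qed
  then have J': "filterlim (\<lambda>n. J n - 1) at_top sequentially"
    by (rule filterlim_compose[OF filterlim_minus_const_nat_at_top])
  have large: "\<forall>\<^sub>F n in sequentially. 1 \<le> J n \<and> 1 < n"
    using \<open>filterlim J at_top sequentially\<close> eventually_gt_at_top[of 1]
    unfolding filterlim_at_top by (auto intro: eventually_conj)
  have bounds: "?r (lac_exp (Suc (J n - 1))) (J n - 1) \<le> (exp (\<beta> * real (J n) powr (7/8)) - 1) / (1 / ln 2 powr \<beta> * ln (real n) powr \<beta>) \<and>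
     (exp (\<beta> * real (J n) powr (7/8)) - 1) / (1 / ln 2 powr \<beta> * ln (real n) powr \<beta>) \<le> ?r (lac_exp (J n - 1)) (J n - 1)"
    if "1 \<le> J n \<and> 1 < n" for n
  proof -
    have pw: "ln (2 ^ m) = real m * ln 2" for m
      by (simp add: ln_realpow)
    have "real n < 2 ^ lac_exp (J n)"
      using J[of n] by (metis of_nat_less_iff of_nat_numeral of_nat_power)
    then have 1: "ln (real n) \<le> real (lac_exp (J n)) * ln 2"
      using that by (subst pw[symmetric], subst ln_le_cancel_iff) auto
    have "2 ^ lac_exp (J n - 1) \<le> n"
      using that by (intro J_le) auto
    then have "2 ^ lac_exp (J n - 1) \<le> real n"
      by (metis of_nat_le_iff of_nat_numeral of_nat_power)
    then have 2: "real (lac_exp (J n - 1)) * ln 2 \<le> ln (real n)"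
      using that by (subst pw[symmetric], subst ln_le_cancel_iff) auto
    have pos: "0 < real (lac_exp (J n - 1)) * ln 2" "0 < ln (real n)"
      using that lac_exp_pos by auto
    have pos': "0 < real (lac_exp (J n)) * ln 2"
      using lac_exp_pos by auto
    have num: "0 \<le> (exp (\<beta> * real (J n) powr (7/8)) - 1) * ln 2 powr \<beta>"
      using assms by simp
    have "ln (real n) powr \<beta> \<le> (real (lac_exp (J n)) * ln 2) powr \<beta>"
      "(real (lac_exp (J n - 1)) * ln 2) powr \<beta> \<le> ln (real n) powr \<beta>"
      using assms pos by (intro powr_mono2 1 2; simp)+
    moreover have "Suc (J n - 1) = J n"
      using that by simp
    ultimately show ?thesis
      using pos pos' by (auto simp del: of_nat_Suc simp: lac_exp_pos intro!: divide_left_mono[OF _ num] mult_pos_pos)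
  qed
  show ?thesis
    unfolding sum_eq
  proof (rule asymp_equivI', rule tendsto_sandwich)
    show "(\<lambda>n. ?r (lac_exp (Suc (J n - 1))) (J n - 1)) \<longlonglongrightarrow> 1" "(\<lambda>n. ?r (lac_exp (J n - 1)) (J n - 1)) \<longlonglongrightarrow> 1"
      using filterlim_compose[OF lim1 J'] filterlim_compose[OF lim2 J'] by simp_all
  qed (use large in eventually_elim, use bounds in blast)+
qed

section \<open>Absolute sum of the coefficients at the sampling points\<close>

text \<open>This is \<open>ln t \<le> t - 1\<close> at \<open>t = y * ln 2 / \<beta>\<close>. The
  constant is the maximum of \<open>2 powr (- y) * y powr \<beta>\<close>, attained at
  \<open>y = \<beta> / ln 2\<close>.\<close>

lemma two_powr_minus_le:
  fixes \<beta> y :: real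
  assumes "0 < \<beta>" "0 < y"
  shows "2 powr (- y) \<le> exp (- \<beta> - \<beta> * ln (ln 2 / \<beta>)) * y powr (- \<beta>)"
proof -
  have "\<beta> * ln (y * (ln 2 / \<beta>)) \<le> \<beta> * (y * (ln 2 / \<beta>) - 1)"
    using assms by (intro mult_left_mono ln_le_minus_one mult_pos_pos) auto
  also have "\<dots> = y * ln 2 - \<beta>"
    using assms by (simp add: field_simps)
  finally have "\<beta> * (ln y + ln (ln 2 / \<beta>)) \<le> y * ln 2 - \<beta>"
    using assms by (subst (asm) ln_mult) auto
  then have "exp (- y * ln 2) \<le> exp (- \<beta> - \<beta> * ln (ln 2 / \<beta>) + - \<beta> * ln y)"
    by (simp add: algebra_simps)
  then show ?thesis
    using assms by (simp add: powr_def exp_add[symmetric])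
qed

lemma suminf_lac_weight_bigo:
  assumes "0 < \<beta>"
  shows "(\<lambda>j. \<Sum>i. sqrt (lac_weight \<beta> i) * 2 powr (- (real (lac_exp i) / real (lac_exp j))))
    \<in> O(\<lambda>j. real j powr (3/16) * sqrt (lac_weight \<beta> j))"
proof -
  let ?w = "\<lambda>i. sqrt (lac_weight \<beta> i)"
  let ?f = "\<lambda>j i. ?w i * 2 powr (- (real (lac_exp i) / real (lac_exp j)))"
  \<comment> \<open>The head and the tail of the series, split at \<open>i = j\<close>, are dominated by the telescoping increments of
    \<open>T\<close> and \<open>T'\<close>; the tail uses \<open>2 powr (- y) = O(y powr (- \<beta>))\<close>.\<close>
  define T where "T i = real i powr (1/8) * exp (\<beta> / 2 * real i powr (7/8))" for i :: nat
  define T' where "T' i = real i powr (1/8) * exp (- (\<beta> / 2 * real i powr (7/8)))" for i :: nat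
  define C where "C = exp (- \<beta> - \<beta> * ln (ln 2 / \<beta>))"
  have w_nonneg: "0 \<le> ?w i" for i
    using lac_weight_pos[OF assms, of i] by simp
  \<comment> \<open>The factor \<open>i powr (1/8)\<close> offsets the derivative of
    \<open>i powr (7/8)\<close>, so the increment has the order of the exponential alone, while
    \<open>?w i\<close> carries a further \<open>i powr (-1/16)\<close> that absorbs all constants.
    The same holds for \<open>T'\<close>.\<close>
  have "\<forall>\<^sub>F i in sequentially. ?w i \<le> T (Suc i) - T i"
    unfolding T_def lac_weight_def using assms by real_asymp
  moreover have "\<forall>\<^sub>F i in sequentially. ?w i * exp (- \<beta> * real i powr (7/8)) \<le> T' i - T' (Suc i)"
    unfolding T'_def lac_weight_def using assms by real_asymp
  ultimately have "\<forall>\<^sub>F i in sequentially. ?w i \<le> T (Suc i) - T i \<and>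
      ?w i * exp (- \<beta> * real i powr (7/8)) \<le> T' i - T' (Suc i)"
    by (rule eventually_conj)
  then obtain i0 where i0: "\<And>i. i0 \<le> i \<Longrightarrow> ?w i \<le> T (Suc i) - T i"
      "\<And>i. i0 \<le> i \<Longrightarrow> ?w i * exp (- \<beta> * real i powr (7/8)) \<le> T' i - T' (Suc i)"
    unfolding eventually_sequentially by blast
  \<comment> \<open>Absorbs the finitely many terms before the comparison with \<open>T\<close>
    holds.\<close>
  define C0 where "C0 = (\<Sum>i<i0. ?w i)"
  have summ: "summable (?f j)" for j
    using summable_lac_weight[of \<beta> "1 / real (lac_exp j)" "1/2"] assms lac_exp_pos[of j] lac_weight_pos[OF assms]
    by (simp add: powr_half_sqrt less_imp_le)
  have bound: "suminf (?f j) \<le> C0 + T j + C * real (lac_exp j) powr \<beta> * T' j" if j: "i0 \<le> j" for j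
  proof -
    let ?m = "real (lac_exp j)"
    have m: "0 < ?m"
      using lac_exp_pos[of j] by simp
    have "(\<Sum>i<j. ?f j i) \<le> (\<Sum>i<j. ?w i)"
    proof (intro sum_mono mult_left_le)
      fix i show "2 powr (- (real (lac_exp i) / ?m)) \<le> 1"
        using powr_mono[of "- (real (lac_exp i) / ?m)" 0 2] m by simp
    qed (rule w_nonneg)
    also have "\<dots> = C0 + (\<Sum>i=i0..<j. ?w i)"
      using j sum.atLeastLessThan_concat[of 0 i0 j ?w] by (simp add: C0_def lessThan_atLeast0)
    also have "(\<Sum>i=i0..<j. ?w i) \<le> (\<Sum>i=i0..<j. T (Suc i) - T i)"
      using i0 by (intro sum_mono) auto
    also have "\<dots> = T j - T i0"
      using j by (rule sum_Suc_diff')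
    also have "\<dots> \<le> T j"
      by (simp add: T_def)
    finally have head: "(\<Sum>i<j. ?f j i) \<le> C0 + T j"
      by simp
    have tele: "(\<lambda>i. C * ?m powr \<beta> * (T' (i + j) - T' (Suc (i + j)))) sums (C * ?m powr \<beta> * (T' j - 0))"
    proof (intro sums_mult)
      have "T' \<longlonglongrightarrow> 0"
        unfolding T'_def[abs_def] using assms by real_asymp
      then have "(\<lambda>i. T' (i + j)) \<longlonglongrightarrow> 0"
        by (rule LIMSEQ_ignore_initial_segment)
      from telescope_sums'[OF this] show "(\<lambda>i. T' (i + j) - T' (Suc (i + j))) sums (T' j - 0)"
        by simp
    qed
    have "suminf (\<lambda>i. ?f j (i + j)) \<le> C * ?m powr \<beta> * (T' j - 0)"
    proof (rule sums_le[OF _ summable_sums tele])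
      show "summable (\<lambda>i. ?f j (i + j))"
        using summ by (rule summable_ignore_initial_segment)
      fix i
      let ?i = "i + j"
      have "2 powr (- (real (lac_exp ?i) / ?m)) \<le> C * (real (lac_exp ?i) / ?m) powr (- \<beta>)"
        unfolding C_def using assms m lac_exp_pos[of ?i] by (intro two_powr_minus_le) auto
      also have "\<dots> = C * ?m powr \<beta> * real (lac_exp ?i) powr (- \<beta>)"
        using m by (simp add: powr_divide powr_minus field_simps)
      also have "\<dots> \<le> C * ?m powr \<beta> * exp (real ?i powr (7/8)) powr (- \<beta>)"
        using assms exp_le_lac_exp[of ?i] by (intro mult_left_mono powr_mono2') (auto simp: C_def)
      also have "\<dots> = C * ?m powr \<beta> * exp (- \<beta> * real ?i powr (7/8))"
        by (simp add: powr_def)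
      finally have "?f j ?i \<le> ?w ?i * (C * ?m powr \<beta> * exp (- \<beta> * real ?i powr (7/8)))"
        using w_nonneg by (intro mult_left_mono) auto
      also have "\<dots> = C * ?m powr \<beta> * (?w ?i * exp (- \<beta> * real ?i powr (7/8)))"
        by simp
      also have "\<dots> \<le> C * ?m powr \<beta> * (T' ?i - T' (Suc ?i))"
        using i0(2)[of ?i] j by (intro mult_left_mono) (auto simp: C_def)
      finally show "?f j ?i \<le> C * ?m powr \<beta> * (T' ?i - T' (Suc ?i))" .
    qed
    with head show ?thesis
      using suminf_split_initial_segment[OF summ, of j j] by simp
  qed
  have "(\<lambda>j. suminf (?f j)) \<in> O(\<lambda>j. C0 + T j + C * real (lac_exp j) powr \<beta> * T' j)"
  proof (intro landau_o.big_mono eventually_sequentiallyI[of i0])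
    fix j assume "i0 \<le> j"
    moreover have "0 \<le> suminf (?f j)"
      using w_nonneg summ by (intro suminf_nonneg) auto
    ultimately show "norm (suminf (?f j)) \<le> norm (C0 + T j + C * real (lac_exp j) powr \<beta> * T' j)"
      using bound[of j] by simp
  qed
  also have "(\<lambda>j. C0 + T j + C * real (lac_exp j) powr \<beta> * T' j) \<in> O(\<lambda>j. real j powr (3/16) * ?w j)"
  proof (intro sum_in_bigo)
    have "(\<lambda>_. 1) \<in> O(\<lambda>j. real j powr (3/16) * ?w j)"
      unfolding lac_weight_def using assms by real_asymp
    then show "(\<lambda>_. C0) \<in> O(\<lambda>j. real j powr (3/16) * ?w j)"
      by (rule landau_o.big_trans[rotated]) simp
    show "T \<in> O(\<lambda>j. real j powr (3/16) * ?w j)"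
      unfolding T_def[abs_def] lac_weight_def using assms by real_asymp
    \<comment> \<open>The left side is asymptotic to \<open>T j\<close>, which exceeds
      \<open>?w j\<close> by the order \<open>j powr (1/8 + 1/16)\<close>.\<close>
    have "(\<lambda>j. real (lac_exp j) powr \<beta> * T' j) \<in> O(\<lambda>j. real j powr (3/16) * ?w j)"
      unfolding T'_def lac_weight_def real_lac_exp using assms by real_asymp
    then show "(\<lambda>j. C * real (lac_exp j) powr \<beta> * T' j) \<in> O(\<lambda>j. real j powr (3/16) * ?w j)"
      by (simp add: C_def mult.assoc)
  qed
  finally show ?thesis .
qed

section \<open>Passage to the limit superior and conclusion\<close>

lemma Limsup_eq_PInf_if_frequently:
  fixes f :: "'a \<Rightarrow> real" and C :: "nat \<Rightarrow> real"
  assumes s: "filterlim s F sequentially" and C: "filterlim C at_top sequentially"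
    and le: "\<exists>\<^sub>F j in sequentially. C j \<le> f (s j)"
  shows "Limsup F (\<lambda>x. ereal (f x)) = \<infinity>"
proof (rule ccontr)
  assume "Limsup F (\<lambda>x. ereal (f x)) \<noteq> \<infinity>"
  then obtain c :: real where "Limsup F (\<lambda>x. ereal (f x)) < ereal c"
    using less_PInf_Ex_of_nat[of "Limsup F (\<lambda>x. ereal (f x))"] by blast
  then have "\<forall>\<^sub>F x in F. f x < c"
    by (auto dest: Limsup_lessD)
  then have "\<forall>\<^sub>F j in sequentially. f (s j) < c"
    using s by (rule eventually_compose_filterlim)
  moreover have "\<forall>\<^sub>F j in sequentially. c \<le> C j"
    using C by (simp add: filterlim_at_top)
  ultimately have "\<forall>\<^sub>F j in sequentially. \<not> C j \<le> f (s j)"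
    by eventually_elim simp
  with le show False
    by (simp add: frequently_def)
qed

text \<open>At \<open>k = 2 ^ lac_exp i\<close> the root of \<open>k\<close> in the coefficient
  cancels \<open>k powr (1/2)\<close>.\<close>

lemma random_dirichlet_lac_coeff:
  "random_dirichlet (lac_coeff \<beta>) \<eta>s s \<omega> =
    (\<Sum>i. sqrt (lac_weight \<beta> i) * 2 powr (- (real (lac_exp i) * s)) * \<eta>s (2 ^ lac_exp i) \<omega>)"
proof -
  let ?h = "\<lambda>a k. a * \<eta>s k \<omega> / real k powr (1/2 + s)"
  have "?h (lac_coeff \<beta> (2 ^ lac_exp i)) (2 ^ lac_exp i) =
      sqrt (lac_weight \<beta> i) * 2 powr (- (real (lac_exp i) * s)) * \<eta>s (2 ^ lac_exp i) \<omega>" for i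
  proof -
    have "(2 ^ lac_exp i :: real) powr s = 2 powr (real (lac_exp i) * s)"
      by (simp add: powr_powr flip: powr_realpow)
    then have *: "real (2 ^ lac_exp i) powr (1/2 + s) = sqrt (2 ^ lac_exp i) * 2 powr (real (lac_exp i) * s)"
      by (simp add: powr_add powr_half_sqrt)
    show ?thesis
      unfolding * lac_coeff_power by (simp add: real_sqrt_mult powr_minus field_simps)
  qed
  moreover have "random_dirichlet (lac_coeff \<beta>) \<eta>s s \<omega> =
      (\<Sum>i. ?h (lac_coeff \<beta> (2 ^ lac_exp i)) (2 ^ lac_exp i))"
    \<comment> \<open>Both sums are descriptions over equivalent \<open>sums\<close> predicates, so
      they agree even without convergence.\<close>
    unfolding random_dirichlet_def suminf_def
    by (intro arg_cong[where f=The] ext sums_lac_coeff_iff[of ?h]) simp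
  ultimately show ?thesis
    by simp
qed

theorem theorem3:
  fixes \<beta> :: real
    and N :: "'b measure" and \<eta> :: "'b \<Rightarrow> real"
    and M :: "'a measure" and \<eta>s :: "nat \<Rightarrow> 'a \<Rightarrow> real"
  assumes "\<beta> > 0"
    and "prob_space N" and "\<eta> \<in> borel_measurable N"
    and "prob_space M" and "independent_copies M \<eta>s N \<eta>"
    and "integrable N \<eta>" and "prob_space.expectation N \<eta> = 0"
    and "integrable N (\<lambda>x. (\<eta> x)\<^sup>2)" and "prob_space.variance N \<eta> > 0"
    and "(\<lambda>x::real. measure N {w \<in> space N. \<eta> w > x}) \<sim>[at_top] (\<lambda>x. 1 / (x * ln x)\<^sup>2)"
  shows "\<exists>a :: nat \<Rightarrow> real.
      \<not> summable (\<lambda>k. (a (Suc k))\<^sup>2 / real (Suc k)) \<and>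
      (\<forall>s>0. summable (\<lambda>k. (a (Suc k))\<^sup>2 / real (Suc k) powr (1 + 2 * s))) \<and>
      (\<exists>c>0. (\<lambda>n. \<Sum>k=1..n. (a k)\<^sup>2 / real k) \<sim>[at_top] (\<lambda>n. c * ln (real n) powr \<beta>)) \<and>
      (AE \<omega> in M. Limsup (at_right 0)
         (\<lambda>s. ereal (s powr (\<beta> / 2) / sqrt (ln (ln (1 / s))) * random_dirichlet a \<eta>s s \<omega>)) = \<infinity>)"
proof -
  interpret N: prob_space N by fact
  interpret M: prob_space M by fact
  note [measurable] = \<open>\<eta> \<in> borel_measurable N\<close>
  note \<beta> = \<open>\<beta> > 0\<close>
  have ind: "M.indep_vars (\<lambda>_. borel) \<eta>s {1..}"
    and distr_eq: "\<And>k. 1 \<le> k \<Longrightarrow> distr M borel (\<eta>s k) = distr N borel \<eta>"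
    using assms(5) by (auto simp: independent_copies_def)
  define \<xi> where "\<xi> j = \<eta>s (2 ^ lac_exp j)" for j
  define w where "w j = sqrt (lac_weight \<beta> j)" for j
  \<comment> \<open>The coefficient of \<open>\<xi> i\<close> in the series at
    \<open>s = 1 / lac_exp j\<close>.\<close>
  define u where "u j i = w i * 2 powr (- (real (lac_exp i) / real (lac_exp j)))" for j i
  \<comment> \<open>\<open>Suc j\<close> keeps the threshold positive at
    \<open>j = 0\<close>.\<close>
  define x where "x j = real (Suc j) powr (7/16)" for j
  define P where "P j = measure N {w \<in> space N. \<eta> w > x j}" for j
  have w_pos: "0 < w j" for j
    using lac_weight_pos[OF \<beta>] by (simp add: w_def)
  have P_nonneg: "0 \<le> P j" for j
    by (simp add: P_def)
  have x_pos: "0 < x j" for j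
    by (simp add: x_def)
  have ind\<xi>: "M.indep_vars (\<lambda>_. borel) \<xi> UNIV"
    unfolding \<xi>_def[abs_def]
    by (rule M.indep_vars_reindex[OF _ _ ind])
      (auto intro: strict_mono_imp_inj_on strict_mono_power_lac_exp)
  then have [measurable]: "\<xi> j \<in> borel_measurable M" for j
    by (auto simp: M.indep_vars_def)
  have distr_\<xi>: "distr M borel (\<xi> j) = distr N borel \<eta>" for j
    unfolding \<xi>_def by (rule distr_eq) simp
  have prob_\<xi>: "M.prob {\<omega> \<in> space M. x j < \<xi> j \<omega>} = P j" for j
  proof -
    have "M.prob {\<omega> \<in> space M. x j < \<xi> j \<omega>} = measure (distr M borel (\<xi> j)) {x j<..}"
      by (subst measure_distr) (auto intro!: arg_cong[where f="measure M"])
    also have "\<dots> = P j"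
      unfolding distr_\<xi> P_def by (subst measure_distr) (auto intro!: arg_cong[where f="measure N"])
    finally show ?thesis .
  qed
  have int_\<xi>: "(\<integral>\<^sup>+\<omega>. ennreal \<bar>\<xi> j \<omega>\<bar> \<partial>M) = ennreal (\<integral>w. \<bar>\<eta> w\<bar> \<partial>N)" for j
  proof -
    have "(\<integral>\<^sup>+\<omega>. ennreal \<bar>\<xi> j \<omega>\<bar> \<partial>M) = (\<integral>\<^sup>+y. ennreal \<bar>y\<bar> \<partial>distr M borel (\<xi> j))"
      by (subst nn_integral_distr) auto
    also have "\<dots> = (\<integral>\<^sup>+w. ennreal \<bar>\<eta> w\<bar> \<partial>N)"
      unfolding distr_\<xi> by (subst nn_integral_distr) auto
    also have "\<dots> = ennreal (\<integral>w. \<bar>\<eta> w\<bar> \<partial>N)"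
      using \<open>integrable N \<eta>\<close> by (intro nn_integral_eq_integral) auto
    finally show ?thesis .
  qed
  have x_lim: "filterlim x at_top sequentially"
    unfolding x_def[abs_def] by real_asymp
  have P_theta: "P \<in> \<Theta>(\<lambda>j. 1 / (x j * ln (x j))\<^sup>2)"
    unfolding P_def[abs_def]
    by (rule asymp_equiv_imp_bigtheta[OF asymp_equiv_compose'[OF assms(10) x_lim]])
  have nsum: "\<not> summable P"
  proof
    assume "summable P"
    \<comment> \<open>The right side has order \<open>j powr (-7/8)\<close> over a squared
      logarithm, which dominates the harmonic terms.\<close>
    have "(\<lambda>j. inverse (real j)) \<in> O(\<lambda>j. 1 / (x j * ln (x j))\<^sup>2)"
      unfolding x_def by real_asymp
    also have "(\<lambda>j. 1 / (x j * ln (x j))\<^sup>2) \<in> O(P)"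
      by (rule bigthetaD1[OF iffD1[OF bigtheta_sym P_theta]])
    finally have "(\<lambda>j. inverse (real j)) \<in> O(P)" .
    moreover have "summable (\<lambda>j. norm (P j))"
      using \<open>summable P\<close> P_nonneg by simp
    ultimately have "summable (\<lambda>j. inverse (real j))"
      by (rule summable_comparison_test_bigo[rotated])
    then show False
      using not_summable_harmonic[where 'a=real] by blast
  qed
  have u_diag: "u j j = w j / 2" for j
    using lac_exp_pos[of j] by (simp add: u_def powr_minus)
  have u_summable: "summable (u j)" for j
    using summable_lac_weight[of \<beta> "1 / real (lac_exp j)" "1/2"] \<beta> lac_exp_pos[of j] lac_weight_pos[OF \<beta>]
    by (simp add: u_def[abs_def] w_def powr_half_sqrt less_imp_le)
  have u_nonneg: "0 \<le> u j i" for j i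
    using w_pos[of i] by (simp add: u_def)
  have u_pos: "0 < u j j" for j
    using w_pos[of j] by (simp add: u_diag)
  have nz: "u j j * x j \<noteq> 0" for j
    using u_pos[of j] x_pos[of j] by simp
  have sum: "summable (\<lambda>j. P j * suminf (u j) / (u j j * x j))"
  proof (rule summable_comparison_test_bigo)
    have "(\<lambda>j. P j * suminf (u j)) \<in> O(\<lambda>j. 1 / (x j * ln (x j))\<^sup>2 * (real j powr (3/16) * w j))"
      unfolding u_def w_def
      by (rule landau_o.big.mult[OF bigthetaD1[OF P_theta] suminf_lac_weight_bigo[OF \<beta>]])
    then have "(\<lambda>j. P j * suminf (u j) / (u j j * x j)) \<in>
        O(\<lambda>j. 1 / (x j * ln (x j))\<^sup>2 * (real j powr (3/16) * w j) / (u j j * x j))"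
      by (rule landau_o.big.divide_right[OF always_eventually[OF allI[OF nz]]])
    also have "(\<lambda>j. 1 / (x j * ln (x j))\<^sup>2 * (real j powr (3/16) * w j) / (u j j * x j)) =
        (\<lambda>j. 2 * (1 / (x j * ln (x j))\<^sup>2 * real j powr (3/16) / x j))"
      using w_pos x_pos by (auto simp: u_diag fun_eq_iff less_imp_neq[symmetric])
    \<comment> \<open>The exponents add up to \<open>-7/8 + 3/16 - 7/16 = -9/8\<close>; the
      logarithms only help.\<close>
    also have "\<dots> \<in> O(\<lambda>j. real j powr (-9/8))"
      unfolding x_def by real_asymp
    finally show "(\<lambda>j. P j * suminf (u j) / (u j j * x j)) \<in> O(\<lambda>j. real j powr (-9/8))" .
    show "summable (\<lambda>j. norm (real j powr (-9/8)))"
      by (simp add: summable_real_powr_iff)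
  qed
  have "AE \<omega> in M. \<exists>\<^sub>F j in sequentially. u j j * x j / 2 \<le> (\<Sum>i. u j i * \<xi> i \<omega>)"
    \<comment> \<open>Here \<open>L\<close> is the first absolute moment of
      \<open>\<eta>\<close>.\<close>
    by (rule M.weighted_series_exceeds_single_term[OF ind\<xi> eq_refl[OF int_\<xi>]])
      (use u_nonneg u_pos u_summable x_pos nsum sum in \<open>simp_all add: prob_\<xi>\<close>)
  moreover have "Limsup (at_right 0)
      (\<lambda>s. ereal (s powr (\<beta> / 2) / sqrt (ln (ln (1 / s))) * random_dirichlet (lac_coeff \<beta>) \<eta>s s \<omega>)) = \<infinity>"
    if freq: "\<exists>\<^sub>F j in sequentially. u j j * x j / 2 \<le> (\<Sum>i. u j i * \<xi> i \<omega>)" for \<omega>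
  proof (rule Limsup_eq_PInf_if_frequently)
    let ?s = "\<lambda>j. 1 / real (lac_exp j)"
    let ?c = "\<lambda>j. ?s j powr (\<beta> / 2) / sqrt (ln (ln (1 / ?s j)))"
    have eq: "random_dirichlet (lac_coeff \<beta>) \<eta>s (?s j) \<omega> = (\<Sum>i. u j i * \<xi> i \<omega>)" for j
      by (simp add: random_dirichlet_lac_coeff u_def w_def \<xi>_def)
    show "filterlim ?s (at_right 0) sequentially"
      unfolding real_lac_exp by real_asymp
    \<comment> \<open>The exponentials cancel, leaving the order
      \<open>j powr (-1/16 + 7/16)\<close> divided by the root of \<open>ln j\<close>.\<close>
    show "filterlim (\<lambda>j. ?c j * (u j j * x j / 2)) at_top sequentially"
      unfolding real_lac_exp u_diag w_def lac_weight_def x_def using \<beta> by real_asymp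
    have "\<forall>\<^sub>F j in sequentially. 0 \<le> ?c j"
      unfolding real_lac_exp using \<beta> by real_asymp
    with freq have "\<exists>\<^sub>F j in sequentially. u j j * x j / 2 \<le> (\<Sum>i. u j i * \<xi> i \<omega>) \<and> 0 \<le> ?c j"
      by (rule frequently_eventually_frequently)
    then show "\<exists>\<^sub>F j in sequentially. ?c j * (u j j * x j / 2) \<le>
        ?c j * random_dirichlet (lac_coeff \<beta>) \<eta>s (?s j) \<omega>"
      unfolding eq by (rule frequently_elim1) (blast intro: mult_left_mono)
  qed
  ultimately have "AE \<omega> in M. Limsup (at_right 0)
      (\<lambda>s. ereal (s powr (\<beta> / 2) / sqrt (ln (ln (1 / s))) * random_dirichlet (lac_coeff \<beta>) \<eta>s s \<omega>)) = \<infinity>"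
    by (auto elim!: eventually_mono)
  moreover have "0 < 1 / ln 2 powr \<beta>"
    by simp
  ultimately show ?thesis
    using not_summable_lac_coeff[OF \<beta>] summable_lac_coeff[OF \<beta>] sum_lac_coeff_asymp_equiv[OF \<beta>]
    by blast
qed

end
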